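(* Let $P$ and $Q$ be Laurent polynomials in $x_1,\ldots,x_r$ with integer coefficients and let $p$ be prime. Then the sequence $\left(\mathrm{ct}(P^nQ)\bmod p\right)_{n\in\mathbb{N}}$ is linearly recurrent if and only if $p\nmid\mathrm{ct}(P^n)$ for all $n\in\mathbb{N}$; moreover there is $B_{P,p}\in\mathbb{N}$, depending only on $p$ and $\deg(P)$ (for fixed $r$), such that it suffices to check this for $n<B_{P,p}$. When the sequence is not linearly recurrent, the value $0$ has frequency $1$ in it. This classification is independent of $Q$.
   Context: $\mathbb{N}=\{0,1,2,\ldots\}$. $\mathrm{ct}(Q)$ denotes the constant term of a Laurent polynomial $Q$; $\deg Q$ denotes the largest absolute value of any exponent of any single variable in $Q$. A sequence $(s_n)$ is uniformly recurrent if for every finite word $w$ occurring in it there is $C_w$ such that every occurrence of $w$ is followed by another occurrence of $w$ starting at distance at most $C_w$; it is linearly recurrent if moreover $C_w$ can be bounded by a constant multiple of the length of $w$ (uniformly in $w$). The frequency of a value $c$ in $(s_n)$ is the asymptotic density of $\{n:s_n=c\}$.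
   Formalization: "Only if" and independence of Q are stated only for sequences not identically 0 mod p: for P=Q=x_1 the sequence is constantly 0, hence linearly recurrent, although p divides ct(P)=0. The linear bound on C_w is required only for nonempty words w. *)

theory Defs
  imports "HOL-Analysis.Finite_Cartesian_Product" "HOL-Library.Poly_Mapping"
    "HOL-Computational_Algebra.Primes"
begin

text \<open>
  Laurent polynomials in finitely many variables with integer coefficients, as the group ring
  of \<open>\<int>\<^sup>r\<close> over \<open>\<int>\<close>: a finitely supported map from exponent vectors to coefficients,
  multiplied by convolution. The variables are indexed by the finite type \<open>'r\<close>, so
  \<open>r = CARD('r)\<close>.
\<close>

type_synonym 'r laurent = "(int ^ 'r) \<Rightarrow>\<^sub>0 int"

definition ct :: "'r::finite laurent \<Rightarrow> int" where
  "ct Q = Poly_Mapping.lookup Q 0"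

text \<open>The inserted \<open>0\<close> only matters for the zero polynomial, which gets degree 0.\<close>

definition laurent_deg :: "'r::finite laurent \<Rightarrow> nat" where
  "laurent_deg Q = Max (insert 0 {nat \<bar>\<alpha> $ i\<bar> | \<alpha> i. \<alpha> \<in> Poly_Mapping.keys Q})"

definition ct_seq :: "nat \<Rightarrow> 'r::finite laurent \<Rightarrow> 'r laurent \<Rightarrow> nat \<Rightarrow> int" where
  "ct_seq p P Q n = ct (P ^ n * Q) mod int p"

definition occurs_at :: "(nat \<Rightarrow> 'a) \<Rightarrow> 'a list \<Rightarrow> nat \<Rightarrow> bool" where
  "occurs_at s w i \<longleftrightarrow> map s [i..<i + length w] = w"

definition recurs_within :: "(nat \<Rightarrow> 'a) \<Rightarrow> 'a list \<Rightarrow> nat \<Rightarrow> bool" where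
  "recurs_within s w C \<longleftrightarrow>
     (\<forall>i. occurs_at s w i \<longrightarrow> (\<exists>j. i < j \<and> j \<le> i + C \<and> occurs_at s w j))"

definition uniformly_recurrent :: "(nat \<Rightarrow> 'a) \<Rightarrow> bool" where
  "uniformly_recurrent s \<longleftrightarrow> (\<forall>w. (\<exists>i. occurs_at s w i) \<longrightarrow> (\<exists>C. recurs_within s w C))"

text \<open>
  The empty word is excluded from the linear bound: it occurs everywhere, so its gap is 1,
  which is no multiple of its length.
\<close>

definition linearly_recurrent :: "(nat \<Rightarrow> 'a) \<Rightarrow> bool" where
  "linearly_recurrent s \<longleftrightarrow> uniformly_recurrent s \<and>
     (\<exists>K. \<forall>w. w \<noteq> [] \<and> (\<exists>i. occurs_at s w i) \<longrightarrow> recurs_within s w (K * length w))"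

definition has_frequency :: "(nat \<Rightarrow> 'a) \<Rightarrow> 'a \<Rightarrow> real \<Rightarrow> bool" where
  "has_frequency s c d \<longleftrightarrow>
     (\<lambda>N. real (card {n. n < N \<and> s n = c}) / real N) \<longlonglongrightarrow> d"

end

theory Submission
  imports Defs "HOL-Number_Theory.Residues"
begin

text \<open>
  Let \<open>\<Lambda>\<close> be the Cartier operator, which keeps the coefficients at exponents divisible by \<open>N = p ^ j\<close>
  and divides these exponents by \<open>N\<close>. By Frobenius,
  \<open>ct (P ^ (q N + r) Q) \<equiv> ct (P ^ q \<Lambda>(P ^ r Q))\<close> modulo \<open>p\<close>, where \<open>\<Lambda>(P ^ r Q)\<close> has degree bounded
  independently of \<open>j\<close> as long as \<open>r < 2 N\<close>. Moreover \<open>\<Lambda> R\<close> is the constant \<open>ct R\<close> once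
  \<open>N > deg R\<close>, so that \<open>ct (P ^ (q + N t) R) \<equiv> ct (P ^ q R) ct (P ^ t)\<close> for \<open>N > q deg P + deg R\<close>.

  If no \<open>ct (P ^ n)\<close> vanishes modulo \<open>p\<close>, then Fermat's little theorem makes \<open>{t. ct (P ^ t) \<equiv> 1}\<close>
  syndetic, hence each of the finitely many functionals \<open>R \<mapsto> ct (P ^ q R)\<close> on polynomials of bounded
  degree recurs with bounded gaps. A word of length about \<open>N\<close> lies in two consecutive blocks of
  length \<open>N\<close>, and the functional of the block index \<open>q\<close> determines its letters.

  If \<open>ct (P ^ m)\<close> vanishes, then a zero-padded copy of \<open>m\<close> among the digits of \<open>n\<close> forces
  \<open>ct (P ^ n Q) \<equiv> 0\<close>. This gives frequency 1, and arbitrarily long runs of zeros that contradict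
  uniform recurrence. The bound \<open>B\<close> exists since there are only finitely many \<open>P\<close> modulo \<open>p\<close> of given
  degree.
\<close>

section \<open>Frobenius modulo a prime in commutative rings\<close>

text \<open>All inner binomial coefficients are multiples of \<open>p\<close>. Divisibility of a
  difference by \<open>of_nat p\<close> serves as congruence modulo \<open>p\<close>, so that it
  applies to Laurent polynomials.\<close>

lemma prime_dvd_add_power_prime:
  fixes a b :: "'a::comm_ring_1"
  assumes "prime p"
  shows "of_nat p dvd (a + b) ^ p - (a ^ p + b ^ p)"
proof -
  have p: "p > 1" using assms prime_gt_1_nat by blast
  have dv: "(of_nat p :: 'a) dvd of_nat (p choose k) * a ^ k * b ^ (p - k)" if "k \<in> {0<..<p}" for k
  proof -
    have "p dvd p choose k"
      using that assms by (intro dvd_choose_prime) auto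
    then have "(of_nat p :: 'a) dvd of_nat (p choose k)"
      by (metis dvd_def of_nat_mult)
    then show ?thesis by (simp add: dvd_mult2)
  qed
  have "{..p} = insert 0 (insert p {0<..<p})" using p by auto
  then have "(a + b) ^ p = a ^ p + b ^ p + (\<Sum>k\<in>{0<..<p}. of_nat (p choose k) * a ^ k * b ^ (p - k))"
    using p by (simp add: binomial_ring algebra_simps)
  then have "(a + b) ^ p - (a ^ p + b ^ p) = (\<Sum>k\<in>{0<..<p}. of_nat (p choose k) * a ^ k * b ^ (p - k))"
    by simp
  also have "of_nat p dvd \<dots>" by (rule dvd_sum) (rule dv)
  finally show ?thesis .
qed

lemma diff_dvd_diff_powers:
  fixes a b :: "'a::comm_ring_1"
  assumes "c dvd a - b"
  shows "c dvd a ^ n - b ^ n"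
  by (metis assms dvd_mult2 power_diff_sumr2)

lemma dvd_diff_trans:
  fixes a b c d :: "'a::comm_ring_1"
  assumes "d dvd a - b" "d dvd b - c"
  shows "d dvd a - c"
  using dvd_add[OF assms] by simp

lemma prime_dvd_add_power_prime_power:
  fixes a b :: "'a::comm_ring_1"
  assumes "prime p"
  shows "of_nat p dvd (a + b) ^ (p ^ j) - (a ^ (p ^ j) + b ^ (p ^ j))"
proof (induction j)
  case (Suc j)
  have "of_nat p dvd ((a + b) ^ (p ^ j)) ^ p - (a ^ (p ^ j) + b ^ (p ^ j)) ^ p"
    by (rule diff_dvd_diff_powers[OF Suc])
  moreover have "of_nat p dvd (a ^ (p ^ j) + b ^ (p ^ j)) ^ p - ((a ^ (p ^ j)) ^ p + (b ^ (p ^ j)) ^ p)"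
    by (rule prime_dvd_add_power_prime[OF assms])
  ultimately have "of_nat p dvd ((a + b) ^ (p ^ j)) ^ p - ((a ^ (p ^ j)) ^ p + (b ^ (p ^ j)) ^ p)"
    by (rule dvd_diff_trans)
  then show ?case by (simp add: power_mult mult.commute[of p])
qed simp

section \<open>Monomials and the Cartier operator\<close>

lemma lookup_of_nat_mult:
  fixes A :: "'a::monoid_add \<Rightarrow>\<^sub>0 int"
  shows "Poly_Mapping.lookup (of_nat n * A) \<alpha> = int n * Poly_Mapping.lookup A \<alpha>"
  by (induction n) (simp_all add: algebra_simps lookup_add)

lemma lookup_frag_of_mult:
  fixes R :: "'a::ab_group_add \<Rightarrow>\<^sub>0 int"
  shows "Poly_Mapping.lookup (frag_of a * R) k = Poly_Mapping.lookup R (k - a)"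
  by (induction R rule: frag_induction[OF subset_UNIV])
     (auto simp: mult_single lookup_single when_def algebra_simps lookup_minus)

lemma frag_of_power: "frag_of a ^ n = (frag_of (((+) a ^^ n) 0) :: 'a::comm_monoid_add \<Rightarrow>\<^sub>0 int)"
  by (induction n) (simp_all add: mult_single)

definition dilate :: "nat \<Rightarrow> int ^ 'r \<Rightarrow> int ^ 'r::finite" where
  "dilate N \<alpha> = (\<chi> i. int N * \<alpha> $ i)"

lemma inj_dilate: "N > 0 \<Longrightarrow> inj (dilate N)"
  by (auto simp: inj_def dilate_def vec_eq_iff)

lemma dilate_zero [simp]: "dilate N 0 = 0"
  by (simp add: dilate_def vec_eq_iff)

lemma dilate_diff: "dilate N (\<alpha> - \<beta>) = dilate N \<alpha> - dilate N \<beta>"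
  by (simp add: dilate_def vec_eq_iff algebra_simps)

lemma funpow_plus_eq_dilate: "((+) \<alpha> ^^ n) 0 = dilate n \<alpha>"
  by (induction n) (auto simp: dilate_def vec_eq_iff algebra_simps)

text \<open>\<open>map_key\<close> precomposes the coefficient function with
  \<open>dilate N\<close>. This needs an injective map, hence the assumption \<open>N > 0\<close> in
  the lemmas on \<open>cartier\<close>.\<close>

definition cartier :: "nat \<Rightarrow> 'r::finite laurent \<Rightarrow> 'r laurent" where
  "cartier N = Poly_Mapping.map_key (dilate N)"

lemma lookup_cartier:
  "N > 0 \<Longrightarrow> Poly_Mapping.lookup (cartier N A) \<alpha> = Poly_Mapping.lookup A (dilate N \<alpha>)"
  by (simp add: cartier_def map_key.rep_eq inj_dilate)

lemma ct_cartier: "N > 0 \<Longrightarrow> ct (cartier N A) = ct A"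
  by (simp add: ct_def lookup_cartier)

lemma cartier_diff: "N > 0 \<Longrightarrow> cartier N (A - B) = cartier N A - cartier N B"
  by (rule poly_mapping_eqI) (simp add: lookup_cartier lookup_minus)

lemma cartier_zero [simp]: "N > 0 \<Longrightarrow> cartier N 0 = 0"
  by (rule poly_mapping_eqI) (simp add: lookup_cartier)

lemma cartier_of_nat_mult: "N > 0 \<Longrightarrow> cartier N (of_nat n * A) = of_nat n * cartier N A"
  by (rule poly_mapping_eqI) (simp add: lookup_cartier lookup_of_nat_mult)

lemma of_nat_dvd_cartier: "N > 0 \<Longrightarrow> of_nat n dvd A \<Longrightarrow> of_nat n dvd cartier N A"
  by (auto simp: dvd_def cartier_of_nat_mult)

lemma cartier_frag_of_power_mult:
  "N > 0 \<Longrightarrow> cartier N (frag_of \<alpha> ^ N * R) = frag_of \<alpha> * cartier N R"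
  by (rule poly_mapping_eqI)
     (simp add: lookup_cartier frag_of_power lookup_frag_of_mult funpow_plus_eq_dilate dilate_diff)

text \<open>For a monomial \<open>P\<close> the identity is exact. It extends to all
  \<open>P\<close> because raising to the power \<open>p ^ j\<close> is additive modulo
  \<open>p\<close>.\<close>

lemma cartier_power_mult:
  assumes "prime p"
  shows "of_nat p dvd cartier (p ^ j) (P ^ (p ^ j) * R) - P * cartier (p ^ j) R"
proof -
  define N where "N = p ^ j"
  have N: "N > 0" using assms by (simp add: N_def prime_gt_0_nat)
  show ?thesis unfolding N_def[symmetric]
  proof (induction P rule: frag_induction[OF subset_UNIV])
    case (3 A B)
    \<comment> \<open>The induction builds polynomials by differences, while Frobenius is stated for
      sums; so \<open>A\<close> is written as \<open>(A - B) + B\<close>.\<close>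
    have "of_nat p dvd ((A - B) + B) ^ N - ((A - B) ^ N + B ^ N)"
      unfolding N_def by (rule prime_dvd_add_power_prime_power[OF assms])
    then have "of_nat p dvd (A ^ N - ((A - B) ^ N + B ^ N)) * R" by (simp add: dvd_mult2)
    then have "of_nat p dvd cartier N ((A ^ N - ((A - B) ^ N + B ^ N)) * R)"
      by (rule of_nat_dvd_cartier[OF N])
    also have "(A ^ N - ((A - B) ^ N + B ^ N)) * R = A ^ N * R - B ^ N * R - (A - B) ^ N * R"
      by (simp add: algebra_simps)
    finally have 1: "of_nat p dvd cartier N (A ^ N * R) - cartier N (B ^ N * R) - cartier N ((A - B) ^ N * R)"
      by (simp only: cartier_diff[OF N])
    have "cartier N ((A - B) ^ N * R) - (A - B) * cartier N R =
      (cartier N (A ^ N * R) - A * cartier N R) - (cartier N (B ^ N * R) - B * cartier N R)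
      - (cartier N (A ^ N * R) - cartier N (B ^ N * R) - cartier N ((A - B) ^ N * R))"
      by (simp add: algebra_simps)
    then show ?case using 1 3 by (simp only: dvd_diff)
  qed (use N in \<open>simp_all add: cartier_frag_of_power_mult power_0_left\<close>)
qed

lemma cartier_power_mult_power:
  assumes "prime p"
  shows "of_nat p dvd cartier (p ^ j) (P ^ (q * p ^ j) * R) - P ^ q * cartier (p ^ j) R"
proof (induction q)
  case (Suc q)
  define N where "N = p ^ j"
  have "of_nat p dvd cartier N (P ^ N * (P ^ (q * N) * R)) - P * cartier N (P ^ (q * N) * R)"
    unfolding N_def by (rule cartier_power_mult[OF assms])
  moreover have "of_nat p dvd P * (cartier N (P ^ (q * N) * R) - P ^ q * cartier N R)"
    using Suc by (simp add: N_def)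
  ultimately have "of_nat p dvd (cartier N (P ^ N * (P ^ (q * N) * R)) - P * cartier N (P ^ (q * N) * R))
     + P * (cartier N (P ^ (q * N) * R) - P ^ q * cartier N R)"
    by (rule dvd_add)
  then show ?case by (simp add: N_def[symmetric] algebra_simps power_add)
qed simp

lemma int_dvd_ct: "of_nat n dvd A \<Longrightarrow> int n dvd ct A"
  by (auto simp: dvd_def ct_def lookup_of_nat_mult)

lemma ct_diff: "ct (A - B) = ct A - ct B"
  by (simp add: ct_def lookup_minus)

lemma ct_cong: "of_nat n dvd A - B \<Longrightarrow> [ct A = ct B] (mod int n)"
  using int_dvd_ct[of n "A - B"] by (simp add: ct_diff cong_iff_dvd_diff)

text \<open>The Cartier operator preserves the constant term, and \<open>P ^ (q * p ^ j)\<close>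
  passes out of it as \<open>P ^ q\<close>. Here \<open>r\<close> may exceed \<open>p ^ j\<close>,
  which serves words that straddle two blocks.\<close>

lemma ct_power_cartier:
  assumes "prime p"
  shows "[ct (P ^ (q * p ^ j + r) * Q) = ct (P ^ q * cartier (p ^ j) (P ^ r * Q))] (mod int p)"
proof -
  have "ct (P ^ (q * p ^ j + r) * Q) = ct (cartier (p ^ j) (P ^ (q * p ^ j) * (P ^ r * Q)))"
    using assms by (simp add: ct_cartier prime_gt_0_nat power_add mult.assoc)
  then show ?thesis
    using ct_cong[OF cartier_power_mult_power[OF assms, of j P q "P ^ r * Q"]] by simp
qed

section \<open>Degree bounds and the splitting of exponents\<close>

lemma laurent_deg_le_iff:
  "laurent_deg A \<le> d \<longleftrightarrow> (\<forall>\<alpha> i. Poly_Mapping.lookup A \<alpha> \<noteq> 0 \<longrightarrow> \<bar>\<alpha> $ i\<bar> \<le> int d)"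
proof -
  have "{nat \<bar>\<alpha> $ i\<bar> | \<alpha> i. \<alpha> \<in> Poly_Mapping.keys A} = (\<lambda>(\<alpha>, i). nat \<bar>\<alpha> $ i\<bar>) ` (Poly_Mapping.keys A \<times> UNIV)"
    by auto
  then have "finite {nat \<bar>\<alpha> $ i\<bar> | \<alpha> i. \<alpha> \<in> Poly_Mapping.keys A}" by simp
  then show ?thesis unfolding laurent_deg_def
    by (subst Max_le_iff) (simp, simp, fastforce simp: in_keys_iff nat_le_iff)
qed

lemma abs_exponent_le_laurent_deg:
  "Poly_Mapping.lookup A \<alpha> \<noteq> 0 \<Longrightarrow> \<bar>\<alpha> $ i\<bar> \<le> int (laurent_deg A)"
  using laurent_deg_le_iff[of A "laurent_deg A"] by simp

lemma laurent_deg_mult: "laurent_deg (A * B) \<le> laurent_deg A + laurent_deg B"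
  unfolding laurent_deg_le_iff
proof (intro allI impI)
  fix \<alpha> i assume "Poly_Mapping.lookup (A * B) \<alpha> \<noteq> 0"
  then obtain \<beta> \<gamma> where "\<alpha> = \<beta> + \<gamma>" "\<beta> \<in> Poly_Mapping.keys A" "\<gamma> \<in> Poly_Mapping.keys B"
    using keys_mult[of A B] by (auto simp: in_keys_iff)
  then show "\<bar>\<alpha> $ i\<bar> \<le> int (laurent_deg A + laurent_deg B)"
    using abs_exponent_le_laurent_deg[of A \<beta> i] abs_exponent_le_laurent_deg[of B \<gamma> i]
    by (simp add: in_keys_iff)
qed

lemma laurent_deg_one [simp]: "laurent_deg (1 :: 'r::finite laurent) = 0"
proof -
  have "laurent_deg (1 :: 'r laurent) \<le> 0"
    unfolding laurent_deg_le_iff by (auto simp: lookup_one when_def)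
  then show ?thesis by simp
qed

lemma laurent_deg_power_mult: "laurent_deg (P ^ n * R) \<le> n * laurent_deg P + laurent_deg R"
proof (induction n)
  case (Suc n)
  then show ?case using laurent_deg_mult[of P "P ^ n * R"] by (simp add: mult.assoc)
qed simp

lemma laurent_deg_cartier:
  assumes "N > 0"
  shows "laurent_deg (cartier N A) \<le> laurent_deg A div N"
  unfolding laurent_deg_le_iff
proof (intro allI impI)
  fix \<alpha> :: "int ^ 'a" and i assume "Poly_Mapping.lookup (cartier N A) \<alpha> \<noteq> 0"
  then have "\<bar>dilate N \<alpha> $ i\<bar> \<le> int (laurent_deg A)"
    using assms abs_exponent_le_laurent_deg by (metis lookup_cartier)
  then have "int N * \<bar>\<alpha> $ i\<bar> \<le> int (laurent_deg A)" by (simp add: dilate_def abs_mult)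
  then have "nat \<bar>\<alpha> $ i\<bar> * N \<le> laurent_deg A"
    by (metis abs_ge_zero int_nat_eq mult.commute of_nat_le_iff of_nat_mult nat_0_le)
  then have "nat \<bar>\<alpha> $ i\<bar> \<le> laurent_deg A div N" using assms by (simp add: less_eq_div_iff_mult_less_eq)
  then show "\<bar>\<alpha> $ i\<bar> \<le> int (laurent_deg A div N)" by linarith
qed

lemma laurent_deg_eq_0: "laurent_deg A = 0 \<Longrightarrow> A = of_int (ct A)"
proof (rule poly_mapping_eqI)
  fix \<alpha> :: "int ^ 'a" assume "laurent_deg A = 0"
  then have "\<alpha> = 0" if "Poly_Mapping.lookup A \<alpha> \<noteq> 0"
    using abs_exponent_le_laurent_deg[OF that] by (simp add: vec_eq_iff)
  then show "Poly_Mapping.lookup A \<alpha> = Poly_Mapping.lookup (of_int (ct A)) \<alpha>"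
    by (auto simp: lookup_of_int when_def ct_def)
qed

lemma cartier_eq_ct:
  assumes "laurent_deg A < N"
  shows "cartier N A = of_int (ct A)"
  using laurent_deg_eq_0[of "cartier N A"] laurent_deg_cartier[of N A] assms
  by (simp add: ct_cartier)

lemma ct_mult_of_int: "ct (A * of_int c) = ct A * c"
proof -
  \<comment> \<open>This reduces integer constants to natural ones, for which the coefficients of a
    product are known.\<close>
  obtain a b where "c = int a - int b" by (rule int_diff_cases)
  then show ?thesis
    by (simp add: ct_def mult.commute[of A] left_diff_distrib lookup_minus lookup_of_nat_mult)
       (simp add: algebra_simps)
qed

text \<open>The degree condition makes the Cartier operator turn \<open>P ^ q * R\<close> into a
  constant, so the low digits \<open>q\<close> decouple from the high digits
  \<open>t\<close>.\<close>

lemma ct_power_split: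
  assumes "prime p" "q * laurent_deg P + laurent_deg R < p ^ k"
  shows "[ct (P ^ (q + p ^ k * t) * R) = ct (P ^ q * R) * ct (P ^ t)] (mod int p)"
proof -
  have "cartier (p ^ k) (P ^ q * R) = of_int (ct (P ^ q * R))"
    using assms laurent_deg_power_mult[of P q R] by (intro cartier_eq_ct) linarith
  then show ?thesis
    using ct_power_cartier[OF assms(1), of P t k q R]
    by (simp add: ct_mult_of_int algebra_simps)
qed

section \<open>Reduction of coefficients modulo \<open>p\<close> and finiteness\<close>

definition laurent_mod :: "nat \<Rightarrow> 'r::finite laurent \<Rightarrow> 'r laurent" where
  "laurent_mod p A = Poly_Mapping.map (\<lambda>c. c mod int p) A"

lemma lookup_laurent_mod:
  "Poly_Mapping.lookup (laurent_mod p A) \<alpha> = Poly_Mapping.lookup A \<alpha> mod int p"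
  by (simp add: laurent_mod_def map.rep_eq when_def)

lemma of_nat_dvd_diff_laurent_mod: "of_nat p dvd A - laurent_mod p A"
proof
  show "A - laurent_mod p A = of_nat p * Poly_Mapping.map (\<lambda>c. c div int p) A"
    by (rule poly_mapping_eqI)
       (simp add: lookup_of_nat_mult lookup_minus lookup_laurent_mod map.rep_eq when_def
         minus_mod_eq_mult_div)
qed

lemma ct_mult_laurent_mod: "[ct (A * B) = ct (A * laurent_mod p B)] (mod int p)"
  using dvd_mult[OF of_nat_dvd_diff_laurent_mod[of p B], of A]
  by (intro ct_cong) (simp add: right_diff_distrib)

lemma ct_power_laurent_mod: "[ct (A ^ n) = ct (laurent_mod p A ^ n)] (mod int p)"
  by (intro ct_cong diff_dvd_diff_powers of_nat_dvd_diff_laurent_mod)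

lemma finite_vec_abs_le: "finite {\<alpha> :: int ^ 'r::finite. \<forall>i. \<bar>\<alpha> $ i\<bar> \<le> d}"
proof -
  have "finite {f :: 'r \<Rightarrow> int. \<forall>i. (i \<in> UNIV \<longrightarrow> f i \<in> {-d..d}) \<and> (i \<notin> UNIV \<longrightarrow> f i = 0)}"
    by (rule finite_set_of_finite_funs) auto
  then have "finite (vec_lambda ` {f :: 'r \<Rightarrow> int. \<forall>i. (i \<in> UNIV \<longrightarrow> f i \<in> {-d..d}) \<and> (i \<notin> UNIV \<longrightarrow> f i = 0)})"
    by simp
  moreover have "{\<alpha> :: int ^ 'r. \<forall>i. \<bar>\<alpha> $ i\<bar> \<le> d} \<subseteq> vec_lambda ` {f :: 'r \<Rightarrow> int. \<forall>i. (i \<in> UNIV \<longrightarrow> f i \<in> {-d..d}) \<and> (i \<notin> UNIV \<longrightarrow> f i = 0)}"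
  proof
    fix \<alpha> :: "int ^ 'r" assume "\<alpha> \<in> {\<alpha>. \<forall>i. \<bar>\<alpha> $ i\<bar> \<le> d}"
    then have "\<bar>\<alpha> $ i\<bar> \<le> d" for i by simp
    then have "- d \<le> \<alpha> $ i \<and> \<alpha> $ i \<le> d" for i by (meson abs_le_iff minus_le_iff)
    then show "\<alpha> \<in> vec_lambda ` {f :: 'r \<Rightarrow> int. \<forall>i. (i \<in> UNIV \<longrightarrow> f i \<in> {-d..d}) \<and> (i \<notin> UNIV \<longrightarrow> f i = 0)}"
      by (intro image_eqI[of _ _ "vec_nth \<alpha>"]) (auto simp: vec_lambda_eta)
  qed
  ultimately show ?thesis by (rule rev_finite_subset)
qed

text \<open>A reduced polynomial of degree at most \<open>d\<close> is determined by a function from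
  a finite box of exponents to \<open>{0..<int p}\<close>.\<close>

lemma finite_laurent_mod:
  assumes "p > 0"
  shows "finite (laurent_mod p ` {A :: 'r::finite laurent. laurent_deg A \<le> d})"
proof -
  define X where "X = {\<alpha> :: int ^ 'r. \<forall>i. \<bar>\<alpha> $ i\<bar> \<le> int d}"
  define F where "F = {f :: int ^ 'r \<Rightarrow> int. \<forall>\<alpha>. (\<alpha> \<in> X \<longrightarrow> f \<alpha> \<in> {0..<int p}) \<and> (\<alpha> \<notin> X \<longrightarrow> f \<alpha> = 0)}"
  have "finite F" unfolding F_def X_def
    by (rule finite_set_of_finite_funs) (auto simp: finite_vec_abs_le)
  moreover have "Poly_Mapping.lookup ` laurent_mod p ` {A :: 'r laurent. laurent_deg A \<le> d} \<subseteq> F"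
  proof -
    have "Poly_Mapping.lookup (laurent_mod p A) \<in> F" if "laurent_deg A \<le> d" for A :: "'r laurent"
      using assms that by (auto simp: F_def X_def lookup_laurent_mod laurent_deg_le_iff) (metis mod_0)
    then show ?thesis by blast
  qed
  ultimately have "finite (Poly_Mapping.lookup ` laurent_mod p ` {A :: 'r laurent. laurent_deg A \<le> d})"
    by (rule rev_finite_subset)
  then show ?thesis by (rule finite_imageD) (auto simp: inj_on_def lookup_inject)
qed

lemma finite_nat_classes_bound:
  fixes f :: "nat \<Rightarrow> 'b"
  assumes "finite (range f)"
  obtains M where "\<And>q. \<exists>q0\<le>M. f q0 = f q"
proof -
  obtain S where S: "finite S" "range f = f ` S"
    using finite_subset_image[OF assms subset_refl] by blast
  have "\<exists>q0\<le>Max S. f q0 = f q" for q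
  proof -
    have "f q \<in> f ` S" using S(2) by (metis rangeI)
    then show ?thesis using Max_ge[OF S(1)] by force
  qed
  then show ?thesis using that by blast
qed

section \<open>Recurrence of the functionals with bounded gaps\<close>

text \<open>These classes of exponents act as the states of an automaton: a class fixes what any
  block of low digits below it will produce.\<close>

definition ct_equiv :: "nat \<Rightarrow> 'r::finite laurent \<Rightarrow> nat \<Rightarrow> nat \<Rightarrow> nat \<Rightarrow> bool" where
  "ct_equiv p P d q q' \<longleftrightarrow>
     (\<forall>R. laurent_deg R \<le> d \<longrightarrow> [ct (P ^ q' * R) = ct (P ^ q * R)] (mod int p))"

text \<open>Modulo \<open>p\<close>, a functional is determined by its values on the finitely many
  reduced polynomials, so there are finitely many functionals.\<close>

lemma ct_equiv_finite_classes:
  fixes P :: "'r::finite laurent"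
  assumes "p > 0"
  obtains M where "\<And>q. \<exists>q0\<le>M. ct_equiv p P d q q0"
proof -
  define V where "V = laurent_mod p ` {A :: 'r laurent. laurent_deg A \<le> d}"
  \<comment> \<open>The value 0 outside \<open>V\<close> places all \<open>f q\<close> in a finite
    set of functions.\<close>
  define f where "f q R = (if R \<in> V then ct (P ^ q * R) mod int p else 0)" for q R
  have "finite {g :: 'r laurent \<Rightarrow> int. \<forall>R. (R \<in> V \<longrightarrow> g R \<in> {0..<int p}) \<and> (R \<notin> V \<longrightarrow> g R = 0)}"
    using finite_laurent_mod[OF assms] unfolding V_def by (intro finite_set_of_finite_funs) auto
  moreover have "range f \<subseteq> {g. \<forall>R. (R \<in> V \<longrightarrow> g R \<in> {0..<int p}) \<and> (R \<notin> V \<longrightarrow> g R = 0)}"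
    using assms by (auto simp: f_def)
  ultimately have "finite (range f)" by (rule rev_finite_subset)
  then obtain M where M: "\<And>q. \<exists>q0\<le>M. f q0 = f q" by (rule finite_nat_classes_bound) blast
  have "ct_equiv p P d q q0" if "f q0 = f q" for q q0
    unfolding ct_equiv_def
  proof (intro allI impI)
    fix R :: "'r laurent" assume "laurent_deg R \<le> d"
    then have "laurent_mod p R \<in> V" by (simp add: V_def)
    then have "[ct (P ^ q0 * laurent_mod p R) = ct (P ^ q * laurent_mod p R)] (mod int p)"
      using fun_cong[OF that, of "laurent_mod p R"] by (simp add: f_def cong_def)
    then show "[ct (P ^ q0 * R) = ct (P ^ q * R)] (mod int p)"
      by (meson ct_mult_laurent_mod cong_sym cong_trans)
  qed
  then show ?thesis using M that by metis
qed

lemma nat_less_prime_power: "prime (p::nat) \<Longrightarrow> \<exists>k. n < p ^ k"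
  by (rule exI[of _ n], rule power_gt_expt) (rule prime_gt_Suc_0_nat)

text \<open>Stacking \<open>e\<close> zero-padded copies of the digits of \<open>t\<close>
  multiplies the constant terms.\<close>

lemma ct_power_power:
  fixes P :: "'r::finite laurent"
  assumes "prime p"
  shows "\<exists>u. [ct (P ^ u) = ct (P ^ t) ^ e] (mod int p)"
proof (induction e)
  case 0
  show ?case by (rule exI[of _ 0]) (simp add: ct_def)
next
  case (Suc e)
  then obtain u where u: "[ct (P ^ u) = ct (P ^ t) ^ e] (mod int p)" by blast
  obtain k where "t * laurent_deg P + laurent_deg (1 :: 'r laurent) < p ^ k"
    using nat_less_prime_power[OF assms] by blast
  from ct_power_split[OF assms this, of u] have "[ct (P ^ (t + p ^ k * u)) = ct (P ^ t) * ct (P ^ u)] (mod int p)"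
    by simp
  also have "[ct (P ^ t) * ct (P ^ u) = ct (P ^ t) * ct (P ^ t) ^ e] (mod int p)"
    using u by (rule cong_scalar_left)
  finally show ?case by auto
qed

text \<open>Below the digits of an arbitrary \<open>t\<close> one can write a bounded
  \<open>u\<close> whose constant term is the inverse of that of \<open>t\<close>.\<close>

lemma ct_power_eq_1_syndetic:
  fixes P :: "'r::finite laurent"
  assumes p: "prime p" and nz: "\<And>n. \<not> int p dvd ct (P ^ n)"
  obtains C where "\<And>N. \<exists>t. N < t \<and> t \<le> N + C \<and> [ct (P ^ t) = 1] (mod int p)"
proof -
  define f where "f t = ct (P ^ t) mod int p" for t
  have "range f \<subseteq> {0..<int p}" using prime_gt_0_nat[OF p] by (auto simp: f_def)
  then have "finite (range f)" by (rule finite_subset) simp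
  then obtain M where M: "\<And>q. \<exists>q0\<le>M. f q0 = f q" by (rule finite_nat_classes_bound) blast
  \<comment> \<open>By Fermat the inverse is the power \<open>p - 2\<close>, which is again some
    \<open>ct (P ^ u)\<close> modulo \<open>p\<close>. Replacing \<open>u\<close> by an index up to
    \<open>M\<close> makes the bound independent of \<open>t\<close>.\<close>
  have inv: "\<exists>u\<le>M. [ct (P ^ u) * ct (P ^ t) = 1] (mod int p)" for t
  proof -
    have "\<exists>u. [ct (P ^ u) = ct (P ^ t) ^ (p - 2)] (mod int p)" by (rule ct_power_power[OF p])
    then obtain u where u: "[ct (P ^ u) = ct (P ^ t) ^ (p - 2)] (mod int p)" by blast
    obtain u' where u': "u' \<le> M" "[ct (P ^ u') = ct (P ^ u)] (mod int p)"
      using M[of u] by (auto simp: f_def cong_def)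
    have "Suc (p - 2) = p - 1" using prime_ge_2_nat[OF p] by simp
    then have "ct (P ^ t) ^ (p - 2) * ct (P ^ t) = ct (P ^ t) ^ (p - 1)"
      by (metis mult.commute power_Suc)
    moreover have "[ct (P ^ t) ^ (p - 1) = 1] (mod int p)"
    proof -
      define c where "c = nat (ct (P ^ t) mod int p)"
      have c: "[int c = ct (P ^ t)] (mod int p)"
        using prime_gt_0_nat[OF p] by (simp add: c_def)
      have "\<not> p dvd c" using nz[of t] cong_dvd_iff[OF c] by simp
      then have "[c ^ (p - 1) = 1] (mod p)" by (rule fermat_theorem[OF p])
      then have "[int c ^ (p - 1) = 1] (mod int p)" by (metis cong_int_iff of_nat_1 of_nat_power)
      then show ?thesis using c by (meson cong_pow cong_sym cong_trans)
    qed
    ultimately have "[ct (P ^ u') * ct (P ^ t) = 1] (mod int p)"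
      using u u'(2) by (metis cong_scalar_right cong_trans)
    then show ?thesis using u'(1) by blast
  qed
  obtain k where k: "M * laurent_deg P < p ^ k" using nat_less_prime_power[OF p] by blast
  have "\<exists>t. N < t \<and> t \<le> N + (M + p ^ k) \<and> [ct (P ^ t) = 1] (mod int p)" for N
  proof -
    define t where "t = Suc (N div p ^ k)"
    obtain u where u: "u \<le> M" "[ct (P ^ u) * ct (P ^ t) = 1] (mod int p)" using inv by blast
    have "u * laurent_deg P + laurent_deg (1 :: 'r laurent) < p ^ k"
      using le_less_trans[OF mult_le_mono1[OF u(1), of "laurent_deg P"] k] by simp
    from ct_power_split[OF p this, of t] u(2) have "[ct (P ^ (u + p ^ k * t)) = 1] (mod int p)"
      using cong_trans by simp blast
    moreover have "N < p ^ k * t" 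
      unfolding t_def using prime_gt_0_nat[OF p] dividend_less_times_div[of "p ^ k" N] by simp
    moreover have "p ^ k * t \<le> N + p ^ k" by (simp add: t_def)
    ultimately show ?thesis using u(1) by (intro exI[of _ "u + p ^ k * t"]) auto
  qed
  then show ?thesis by (rule that)
qed

text \<open>Writing a \<open>t\<close> with \<open>ct (P ^ t)\<close> congruent to 1 above the
  digits of \<open>q\<close> does not change the functional. The gap found here depends on
  \<open>q\<close>, through \<open>k\<close>.\<close>

lemma ct_equiv_syndetic:
  fixes P :: "'r::finite laurent"
  assumes p: "prime p" and nz: "\<And>n. \<not> int p dvd ct (P ^ n)"
  shows "\<exists>C. \<forall>N. \<exists>q'. N < q' \<and> q' \<le> N + C \<and> ct_equiv p P d q q'"
proof -
  obtain C where C: "\<And>N. \<exists>t. N < t \<and> t \<le> N + C \<and> [ct (P ^ t) = 1] (mod int p)"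
    using ct_power_eq_1_syndetic[OF assms, of thesis] by blast
  obtain k where k: "q * laurent_deg P + d < p ^ k" using nat_less_prime_power[OF p] by blast
  have "\<exists>q'. N < q' \<and> q' \<le> N + (q + p ^ k * C) \<and> ct_equiv p P d q q'" for N
  proof -
    obtain t where t: "N div p ^ k < t" "t \<le> N div p ^ k + C" "[ct (P ^ t) = 1] (mod int p)"
      using C by blast
    have "p ^ k * Suc (N div p ^ k) \<le> p ^ k * t" using t(1) by (intro mult_le_mono2) simp
    then have "N < p ^ k * t"
      using prime_gt_0_nat[OF p] dividend_less_times_div[of "p ^ k" N] by simp
    moreover have "p ^ k * t \<le> p ^ k * (N div p ^ k) + p ^ k * C"
      using t(2) by (metis add_mult_distrib2 mult_le_mono2)
    then have "p ^ k * t \<le> N + p ^ k * C"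
      using times_div_less_eq_dividend[of "p ^ k" N] by linarith
    moreover have "ct_equiv p P d q (q + p ^ k * t)"
      unfolding ct_equiv_def
    proof (intro allI impI)
      fix R :: "'r laurent" assume "laurent_deg R \<le> d"
      then have "[ct (P ^ (q + p ^ k * t) * R) = ct (P ^ q * R) * ct (P ^ t)] (mod int p)"
        using k by (intro ct_power_split[OF p]) linarith
      also have "[ct (P ^ q * R) * ct (P ^ t) = ct (P ^ q * R) * 1] (mod int p)"
        using t(3) by (rule cong_scalar_left)
      finally show "[ct (P ^ (q + p ^ k * t) * R) = ct (P ^ q * R)] (mod int p)" by simp
    qed
    ultimately show ?thesis by (intro exI[of _ "q + p ^ k * t"]) auto
  qed
  then show ?thesis by blast
qed

text \<open>Finitely many classes have representatives up to \<open>M\<close>, so the maximum of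
  their gaps serves every \<open>q\<close>.\<close>

lemma ct_equiv_uniformly_syndetic:
  fixes P :: "'r::finite laurent"
  assumes p: "prime p" and nz: "\<And>n. \<not> int p dvd ct (P ^ n)"
  obtains C where "\<And>q N. \<exists>q'. N < q' \<and> q' \<le> N + C \<and> ct_equiv p P d q q'"
proof -
  obtain M where M: "\<And>q. \<exists>q0\<le>M. ct_equiv p P d q q0"
    by (rule ct_equiv_finite_classes[OF prime_gt_0_nat[OF p], of P d]) blast
  obtain C where C: "\<And>q N. \<exists>q'. N < q' \<and> q' \<le> N + C q \<and> ct_equiv p P d q q'"
    using ct_equiv_syndetic[OF assms] by metis
  have "\<exists>q'. N < q' \<and> q' \<le> N + Max (C ` {..M}) \<and> ct_equiv p P d q q'" for q N
  proof -
    obtain q0 where q0: "q0 \<le> M" "ct_equiv p P d q q0" using M by blast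
    obtain q' where q': "N < q'" "q' \<le> N + C q0" "ct_equiv p P d q0 q'" using C by blast
    have "ct_equiv p P d q q'"
      using q0(2) q'(3) unfolding ct_equiv_def by (meson cong_trans)
    moreover have "C q0 \<le> Max (C ` {..M})" using q0(1) by (intro Max_ge) auto
    ultimately show ?thesis using q' by (intro exI[of _ q']) auto
  qed
  then show ?thesis by (rule that)
qed

section \<open>Linear recurrence when no constant term vanishes\<close>

text \<open>The bound is free of \<open>N\<close>, so one class of functionals handles all block
  lengths. It is used with \<open>c = 2\<close> for two adjacent blocks and with
  \<open>c = 1\<close> for a single one.\<close>

lemma laurent_deg_cartier_power_mult:
  assumes "N > 0" "r < c * N"
  shows "laurent_deg (cartier N (P ^ r * Q)) \<le> c * laurent_deg P + laurent_deg Q"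
proof -
  have "laurent_deg (cartier N (P ^ r * Q)) \<le> (r * laurent_deg P + laurent_deg Q) div N"
    using laurent_deg_cartier[OF assms(1)] laurent_deg_power_mult
    by (meson div_le_mono le_trans)
  also have "\<dots> \<le> ((c * laurent_deg P + laurent_deg Q) * N) div N"
  proof (rule div_le_mono)
    have "r * laurent_deg P \<le> c * N * laurent_deg P" using assms(2) by (intro mult_le_mono1) simp
    moreover have "laurent_deg Q * 1 \<le> laurent_deg Q * N" using assms(1) by (intro mult_le_mono2) linarith
    ultimately have "r * laurent_deg P + laurent_deg Q * 1 \<le> c * N * laurent_deg P + laurent_deg Q * N"
      by (rule add_mono)
    then show "r * laurent_deg P + laurent_deg Q \<le> (c * laurent_deg P + laurent_deg Q) * N"
      by (simp add: algebra_simps)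
  qed
  also have "\<dots> = c * laurent_deg P + laurent_deg Q" using assms(1) by simp
  finally show ?thesis .
qed

lemma ct_seq_block:
  assumes "prime p" "ct_equiv p P (2 * laurent_deg P + laurent_deg Q) q q'" "r < 2 * p ^ j"
  shows "ct_seq p P Q (q' * p ^ j + r) = ct_seq p P Q (q * p ^ j + r)"
proof -
  define R where "R = cartier (p ^ j) (P ^ r * Q)"
  have "laurent_deg R \<le> 2 * laurent_deg P + laurent_deg Q"
    unfolding R_def using assms prime_gt_0_nat by (intro laurent_deg_cartier_power_mult) auto
  then have "[ct (P ^ q' * R) = ct (P ^ q * R)] (mod int p)"
    using assms(2) by (simp add: ct_equiv_def)
  then have "[ct (P ^ (q' * p ^ j + r) * Q) = ct (P ^ (q * p ^ j + r) * Q)] (mod int p)"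
    unfolding R_def by (meson ct_power_cartier[OF assms(1)] cong_trans cong_sym)
  then show ?thesis by (simp add: ct_seq_def cong_def)
qed

lemma occurs_at_iff: "occurs_at s w i \<longleftrightarrow> (\<forall>k<length w. s (i + k) = w ! k)"
  unfolding occurs_at_def list_eq_iff_nth_eq by simp

lemma linearly_recurrentI:
  assumes "\<And>w. w \<noteq> [] \<Longrightarrow> recurs_within s w (K * length w)"
  shows "linearly_recurrent s"
proof -
  have "recurs_within s [] 1" by (auto simp: recurs_within_def occurs_at_def)
  then have "\<exists>C. recurs_within s w C" for w using assms by (cases "w = []") auto
  then have "uniformly_recurrent s" unfolding uniformly_recurrent_def by simp
  then show ?thesis unfolding linearly_recurrent_def using assms by blast
qed

lemma ct_seq_linearly_recurrent:
  fixes P Q :: "'r::finite laurent"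
  assumes p: "prime p" and nz: "\<And>n. \<not> int p dvd ct (P ^ n)"
  shows "linearly_recurrent (ct_seq p P Q)"
proof -
  define d where "d = 2 * laurent_deg P + laurent_deg Q"
  obtain C where C: "\<And>q N. \<exists>q'. N < q' \<and> q' \<le> N + C \<and> ct_equiv p P d q q'"
    by (rule ct_equiv_uniformly_syndetic[OF assms, of d]) blast
  show ?thesis
  proof (rule linearly_recurrentI)
    fix w :: "int list" assume "w \<noteq> []"
    define l where "l = length w"
    have l: "l > 0" using \<open>w \<noteq> []\<close> by (simp add: l_def)
    \<comment> \<open>\<open>p ^ Suc j\<close> is the least power of \<open>p\<close> above the word
      length: a word starting in one block ends at the latest in the next, and the block is at most
      \<open>p\<close> times as long as the word.\<close>
    obtain j where j: "p ^ j \<le> l" "l < p ^ Suc j"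
      using ex_power_ivl1[of p l] l prime_ge_2_nat[OF p] by auto
    define N where "N = p ^ Suc j"
    have N: "l < N" "N \<le> p * l" "N > 0" using j prime_gt_0_nat[OF p] by (auto simp: N_def)
    show "recurs_within (ct_seq p P Q) w (C * p * length w)"
      unfolding recurs_within_def
    proof (intro allI impI)
      fix i assume occ: "occurs_at (ct_seq p P Q) w i"
      define q r where "q = i div N" and "r = i mod N"
      have i: "i = q * N + r" "r < N" using N by (simp_all add: q_def r_def)
      obtain q' where q': "q < q'" "q' \<le> q + C" "ct_equiv p P d q q'" using C by blast
      have "occurs_at (ct_seq p P Q) w (q' * N + r)"
        unfolding occurs_at_iff
      proof (intro allI impI)
        fix k assume k: "k < length w"
        then have "ct_seq p P Q (q' * p ^ Suc j + (r + k)) = ct_seq p P Q (q * p ^ Suc j + (r + k))"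
          using i(2) N(1) q'(3) l_def by (intro ct_seq_block[OF p]) (simp_all add: d_def N_def)
        then show "ct_seq p P Q (q' * N + r + k) = w ! k"
          using occ k i(1) by (simp add: occurs_at_iff N_def add.assoc)
      qed
      moreover have "i < q' * N + r" using i q'(1) N(3) by simp
      moreover have "q' * N \<le> q * N + C * (p * l)"
        proof -
        have "q' * N \<le> (q + C) * N" using q'(2) by (rule mult_le_mono1)
        also have "\<dots> = q * N + C * N" by (rule add_mult_distrib)
        also have "\<dots> \<le> q * N + C * (p * l)" using N(2) by (intro add_left_mono mult_le_mono2)
        finally show ?thesis .
      qed
      ultimately show "\<exists>j>i. j \<le> i + C * p * length w \<and> occurs_at (ct_seq p P Q) w j"
        using i(1) l_def by (intro exI[of _ "q' * N + r"]) (auto simp: mult.assoc)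
    qed
  qed
qed

section \<open>Forced zeros when some constant term vanishes\<close>

text \<open>
  The indices are those with \<open>w\<close> among their base-\<open>N\<close> digits, leading zeros counting as digits.
\<close>

definition digit_forces :: "(nat \<Rightarrow> 'a) \<Rightarrow> 'a \<Rightarrow> nat \<Rightarrow> nat \<Rightarrow> bool" where
  "digit_forces s z N w \<longleftrightarrow> (\<forall>j r t. r < N ^ j \<longrightarrow> s (r + N ^ j * (w + N * t)) = z)"

text \<open>The forcing digit in base \<open>p ^ (k + l)\<close> is \<open>m0\<close> followed by
  \<open>k\<close> low zeros in base \<open>p\<close>. The zeros collapse everything below to a
  constant; then \<open>ct (P ^ m0)\<close> splits off as a factor.\<close>

lemma ct_seq_digit_forces:
  fixes P Q :: "'r::finite laurent"
  assumes p: "prime p" and m0: "int p dvd ct (P ^ m0)"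
  obtains N w where "N \<ge> 2" "w < N" "digit_forces (ct_seq p P Q) 0 N w"
proof -
  define d where "d = laurent_deg P + laurent_deg Q"
  \<comment> \<open>The successor guarantees \<open>p ^ k\<close> at least 2, hence \<open>N\<close>
    at least 2.\<close>
  obtain k where k: "Suc d < p ^ k" using nat_less_prime_power[OF p] by blast
  \<comment> \<open>The first summand permits the splitting at \<open>m0\<close>; the second makes
    \<open>p ^ k * m0\<close> a single digit in base \<open>N\<close>.\<close>
  obtain l where l: "m0 * laurent_deg P + m0 < p ^ l" using nat_less_prime_power[OF p] by blast
  define N where "N = p ^ (k + l)"
  have p0: "p > 0" using prime_gt_0_nat[OF p] .
  have "2 \<le> p ^ k * 1" using k by linarith
  also have "p ^ k * 1 \<le> p ^ k * p ^ l" using p0 by (intro mult_le_mono2) (simp add: Suc_leI)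
  finally have "N \<ge> 2" by (simp add: N_def power_add)
  moreover have "p ^ k * m0 < N" using l p0 by (simp add: N_def power_add)
  moreover have "digit_forces (ct_seq p P Q) 0 N (p ^ k * m0)"
    unfolding digit_forces_def
  proof (intro allI impI)
    fix j r t assume r: "r < N ^ j"
    define R where "R = cartier (N ^ j) (P ^ r * Q)"
    have "laurent_deg R \<le> 1 * laurent_deg P + laurent_deg Q"
      unfolding R_def using r by (intro laurent_deg_cartier_power_mult) linarith+
    then have R: "cartier (p ^ k) R = of_int (ct R)" using k by (intro cartier_eq_ct) (simp add: d_def)
    define q where "q = m0 + p ^ l * t"
    have Nj: "N ^ j = p ^ ((k + l) * j)" by (simp add: N_def power_mult)
    have q: "p ^ k * m0 + N * t = q * p ^ k + 0" by (simp add: q_def N_def power_add algebra_simps)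
    have "[ct (P ^ ((p ^ k * m0 + N * t) * N ^ j + r) * Q) = ct (P ^ (p ^ k * m0 + N * t) * R)] (mod int p)"
      unfolding R_def Nj by (rule ct_power_cartier[OF p])
    also have "[ct (P ^ (p ^ k * m0 + N * t) * R) = ct (P ^ q * cartier (p ^ k) (P ^ 0 * R))] (mod int p)"
      unfolding q by (rule ct_power_cartier[OF p])
    also have "ct (P ^ q * cartier (p ^ k) (P ^ 0 * R)) = ct (P ^ q) * ct R"
      by (simp add: R ct_mult_of_int)
    also have "[ct (P ^ q) * ct R = ct (P ^ m0) * ct (P ^ t) * ct R] (mod int p)"
      using ct_power_split[OF p, of m0 P 1 l t] l unfolding q_def by (intro cong_scalar_right) simp
    also have "[ct (P ^ m0) * ct (P ^ t) * ct R = 0] (mod int p)"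
      using m0 by (simp add: cong_0_iff)
    finally show "ct_seq p P Q (r + N ^ j * (p ^ k * m0 + N * t)) = 0"
      by (simp add: ct_seq_def cong_def algebra_simps)
  qed
  ultimately show ?thesis by (rule that)
qed

text \<open>Splitting off the last digit leaves \<open>N - 1\<close> choices for it and reduces
  \<open>k\<close> by one; \<open>b\<close> counts the unrestricted leading parts.\<close>

lemma card_digit_avoiding:
  assumes "w < N"
  shows "finite {n. n < b * N ^ k \<and> (\<forall>j<k. n div N ^ j mod N \<noteq> w)}" (is "finite (?H k)")
    and "card {n. n < b * N ^ k \<and> (\<forall>j<k. n div N ^ j mod N \<noteq> w)} \<le> b * (N - 1) ^ k"
proof -
  show fin: "finite (?H k)" for k by simp
  show "card (?H k) \<le> b * (N - 1) ^ k"
  proof (induction k)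
    case (Suc k)
    let ?f = "\<lambda>n. (n mod N, n div N)"
    have "inj_on ?f (?H (Suc k))"
      by (rule inj_onI) (metis div_mult_mod_eq prod.inject)
    moreover have "?f ` ?H (Suc k) \<subseteq> ({..<N} - {w}) \<times> ?H k"
    proof clarsimp
      fix n assume n: "n < b * (N * N ^ k)" "\<forall>j<Suc k. n div N ^ j mod N \<noteq> w"
      have "n div N < b * N ^ k"
        using n(1) assms by (simp add: div_less_iff_less_mult algebra_simps)
      moreover have "n mod N \<noteq> w" using n(2)[rule_format, of 0] by simp
      moreover have "n div N div N ^ j mod N \<noteq> w" if "j < k" for j
        using n(2)[rule_format, of "Suc j"] that by (simp add: div_mult2_eq)
      ultimately show "n mod N < N \<and> n mod N \<noteq> w \<and> n div N < b * N ^ k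
          \<and> (\<forall>j<k. n div N div N ^ j mod N \<noteq> w)"
        using assms by auto
    qed
    ultimately have "card (?H (Suc k)) \<le> card (({..<N} - {w}) \<times> ?H k)"
      by (rule card_inj_on_le) simp
    also have "\<dots> = (N - 1) * card (?H k)" using assms by (simp add: card_cartesian_product)
    also have "\<dots> \<le> (N - 1) * (b * (N - 1) ^ k)" using Suc by (rule mult_le_mono2)
    finally show ?case by (simp add: algebra_simps)
  qed simp
qed

lemma digit_forces_card_le:
  assumes "w < N" "digit_forces s z N w"
  shows "card {n. n < M \<and> s n \<noteq> z} \<le> (M div N ^ k + 1) * (N - 1) ^ k"
proof -
  \<comment> \<open>\<open>M\<close> is rounded up to a multiple of \<open>N ^ k\<close>; only the
    lowest \<open>k\<close> digits are examined.\<close>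
  let ?H = "{n. n < (M div N ^ k + 1) * N ^ k \<and> (\<forall>j<k. n div N ^ j mod N \<noteq> w)}"
  have "s n = z" if "n div N ^ j mod N = w" for n j
  proof -
    have "n = n mod N ^ j + N ^ j * (w + N * (n div N ^ j div N))"
      using that by (metis add.commute mult_div_mod_eq)
    moreover have "n mod N ^ j < N ^ j" using assms(1) by simp
    ultimately show ?thesis using assms(2) unfolding digit_forces_def by metis
  qed
  moreover have "M < (M div N ^ k + 1) * N ^ k"
    using assms(1) dividend_less_div_times[of "N ^ k" M] by simp
  ultimately have "{n. n < M \<and> s n \<noteq> z} \<subseteq> ?H" by auto
  then have "card {n. n < M \<and> s n \<noteq> z} \<le> card ?H"
    by (rule card_mono[OF card_digit_avoiding(1)[OF assms(1)]])
  also have "\<dots> \<le> (M div N ^ k + 1) * (N - 1) ^ k" by (rule card_digit_avoiding(2)[OF assms(1)])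
  finally show ?thesis .
qed

lemma digit_forces_has_frequency:
  assumes "w < N" "digit_forces s z N w"
  shows "has_frequency s z 1"
proof -
  define c where "c M = card {n. n < M \<and> s n \<noteq> z}" for M
  have "(\<lambda>M. real (c M) / real M) \<longlonglongrightarrow> 0"
  proof (rule LIMSEQ_I)
    fix e :: real assume e: "e > 0"
    define \<rho> where "\<rho> = real (N - 1) / real N"
    have "\<rho> < 1" using assms(1) by (auto simp: \<rho>_def)
    \<comment> \<open>First \<open>k\<close> makes the main term less than \<open>e / 2\<close>;
      then, with \<open>k\<close> fixed, \<open>M0\<close> does the same for the rounding
      term.\<close>
    obtain k where k: "\<rho> ^ k < e / 2" using real_arch_pow_inv[of "e / 2" \<rho>] e \<open>\<rho> < 1\<close> by auto
    obtain M0 :: nat where M0: "real M0 > real (N - 1) ^ k * 2 / e" using reals_Archimedean2 by blast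
    show "\<exists>M0. \<forall>M\<ge>M0. norm (real (c M) / real M - 0) < e"
    proof (intro exI allI impI)
      fix M assume "M \<ge> Suc M0"
      then have M: "real M > 0" "real (N - 1) ^ k * 2 / e < real M" using M0 by linarith+
      have "real (c M) \<le> (real (M div N ^ k) + 1) * real (N - 1) ^ k"
        using iffD2[OF of_nat_le_iff, OF digit_forces_card_le[OF assms, of M k]]
        unfolding c_def of_nat_mult of_nat_add of_nat_power of_nat_1 .
      also have "\<dots> \<le> (real M / real N ^ k + 1) * real (N - 1) ^ k"
        using of_nat_div_le_of_nat[of M "N ^ k", where ?'a=real] by (intro mult_right_mono add_right_mono) simp_all
      also have "\<dots> = real M * \<rho> ^ k + real (N - 1) ^ k"
        by (simp add: \<rho>_def power_divide algebra_simps)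
      also have "\<dots> < real M * (e / 2) + real M * (e / 2)"
        using M e k by (intro add_strict_mono mult_strict_left_mono) (auto simp: field_simps)
      finally have "real (c M) < e * real M" by simp
      then show "norm (real (c M) / real M - 0) < e" using M by (simp add: field_simps)
    qed
  qed
  then have "(\<lambda>M. 1 - real (c M) / real M) \<longlonglongrightarrow> 1 - 0" by (intro tendsto_diff tendsto_const)
  moreover have "\<forall>\<^sub>F M in sequentially. 1 - real (c M) / real M = real (card {n. n < M \<and> s n = z}) / real M"
    using eventually_gt_at_top[of 0]
  proof eventually_elim
    case (elim M)
    have "{..<M} = {n. n < M \<and> s n \<noteq> z} \<union> {n. n < M \<and> s n = z}" by auto
    moreover have "card ({n. n < M \<and> s n \<noteq> z} \<union> {n. n < M \<and> s n = z}) = c M + card {n. n < M \<and> s n = z}"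
      unfolding c_def by (rule card_Un_disjoint) auto
    ultimately have "real M = real (c M) + real (card {n. n < M \<and> s n = z})"
      by (metis card_lessThan of_nat_add)
    then show ?case using elim by (simp add: field_simps)
  qed
  ultimately show ?thesis unfolding has_frequency_def
    using Lim_transform_eventually by fastforce
qed

text \<open>Stepping from one occurrence to the next cannot skip a window of length
  \<open>C\<close>, so a word that recurs never disappears for long.\<close>

lemma recurs_within_occurs_after:
  assumes "recurs_within s w C" "occurs_at s w i" "i \<le> a"
  shows "\<exists>j\<ge>a. j \<le> a + C \<and> occurs_at s w j"
  using assms(3)
proof (induction a rule: dec_induct)
  case base
  then show ?case using assms(2) by auto
next
  case (step a)
  then obtain j where j: "a \<le> j" "j \<le> a + C" "occurs_at s w j" by blast
  show ?case
  proof (cases "j = a")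
    case True
    then obtain j' where "a < j'" "j' \<le> a + C" "occurs_at s w j'"
      using assms(1) j(3) unfolding recurs_within_def by blast
    then show ?thesis by (intro exI[of _ j']) auto
  next
    case False
    then show ?thesis using j by (intro exI[of _ j]) auto
  qed
qed

text \<open>The free low part \<open>r\<close> yields runs of \<open>z\<close> of length
  \<open>N ^ j\<close>, longer than any proposed gap for the letter \<open>s n0\<close>.\<close>

lemma digit_forces_not_uniformly_recurrent:
  assumes "N \<ge> 2" "digit_forces s z N w" "s n0 \<noteq> z"
  shows "\<not> uniformly_recurrent s"
proof
  assume "uniformly_recurrent s"
  moreover have occ: "occurs_at s [s n0] n0" by (simp add: occurs_at_iff)
  ultimately obtain C where C: "recurs_within s [s n0] C" unfolding uniformly_recurrent_def by blast
  obtain j where j: "C + n0 < N ^ j" using assms(1) power_gt_expt[of N "C + n0"] by auto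
  \<comment> \<open>Taking \<open>t = 1\<close> puts the start of the run at or after
    \<open>N ^ j\<close>, hence past \<open>n0\<close>, even if \<open>w\<close> is 0.\<close>
  have "N ^ j * 1 \<le> N ^ j * (w + N * 1)" using assms(1) by (intro mult_le_mono2) simp
  then have "n0 \<le> N ^ j * (w + N * 1)" using j by linarith
  from recurs_within_occurs_after[OF C occ this] obtain i where
    i: "N ^ j * (w + N * 1) \<le> i" "i \<le> N ^ j * (w + N * 1) + C" "occurs_at s [s n0] i"
    by blast
  define r where "r = i - N ^ j * (w + N * 1)"
  have "i = r + N ^ j * (w + N * 1)" "r < N ^ j" using i j unfolding r_def by linarith+
  then have "s i = z" using assms(2) unfolding digit_forces_def by blast
  then show False using i(3) assms(3) by (simp add: occurs_at_def)
qed

section \<open>The bound on the exponents to check, and the classification\<close>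

lemma ct_power_divisible_bound:
  assumes "p > 0"
  obtains b where "\<And>(P :: 'r::finite laurent) n. \<lbrakk>laurent_deg P \<le> d; int p dvd ct (P ^ n)\<rbrakk>
    \<Longrightarrow> \<exists>m<b. int p dvd ct (P ^ m)"
proof -
  \<comment> \<open>If no exponent qualifies, \<open>L A\<close> is an unspecified number; it can
    only enlarge the maximum of \<open>S\<close>.\<close>
  define L :: "'r laurent \<Rightarrow> nat" where "L A = (LEAST n. int p dvd ct (A ^ n))" for A
  define S where "S = L ` laurent_mod p ` {A. laurent_deg A \<le> d}"
  have dvd: "int p dvd ct (P ^ n) \<longleftrightarrow> int p dvd ct (laurent_mod p P ^ n)" for P :: "'r laurent" and n
    by (rule cong_dvd_iff[OF ct_power_laurent_mod])
  have "\<exists>m<Suc (Max S). int p dvd ct (P ^ m)"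
    if "laurent_deg P \<le> d" "int p dvd ct (P ^ n)" for P :: "'r laurent" and n
  proof (intro exI conjI)
    have "L (laurent_mod p P) \<le> Max S"
      using that(1) finite_laurent_mod[OF assms] by (intro Max_ge) (auto simp: S_def)
    then show "L (laurent_mod p P) < Suc (Max S)" by simp
    have "int p dvd ct (laurent_mod p P ^ n)" using that(2) by (rule dvd[THEN iffD1])
    then have "int p dvd ct (laurent_mod p P ^ L (laurent_mod p P))" unfolding L_def by (rule LeastI)
    then show "int p dvd ct (P ^ L (laurent_mod p P))" by (rule dvd[THEN iffD2])
  qed
  then show ?thesis by (rule that)
qed

text \<open>If the sequence vanishes identically, as for \<open>Q = 0\<close>, it is linearly
  recurrent whatever \<open>P\<close> is. Hence the equivalence and the independence of
  \<open>Q\<close> are asserted for sequences with a nonzero term.\<close>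

theorem theorem16:
  "\<exists>B :: nat \<Rightarrow> nat \<Rightarrow> nat. \<forall>(p :: nat) (P :: 'r::finite laurent). prime p \<longrightarrow>
     (\<forall>Q :: 'r laurent.
        ((\<forall>n. \<not> int p dvd ct (P ^ n)) \<longrightarrow> linearly_recurrent (ct_seq p P Q)) \<and>
        ((\<exists>n. ct_seq p P Q n \<noteq> 0) \<longrightarrow>
           (linearly_recurrent (ct_seq p P Q) \<longleftrightarrow> (\<forall>n. \<not> int p dvd ct (P ^ n)))) \<and>
        (\<not> linearly_recurrent (ct_seq p P Q) \<longrightarrow> has_frequency (ct_seq p P Q) 0 1)) \<and>
     ((\<forall>n. \<not> int p dvd ct (P ^ n)) \<longleftrightarrow>
        (\<forall>n < B p (laurent_deg P). \<not> int p dvd ct (P ^ n))) \<and>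
     (\<forall>Q Q' :: 'r laurent. (\<exists>n. ct_seq p P Q n \<noteq> 0) \<and> (\<exists>n. ct_seq p P Q' n \<noteq> 0) \<longrightarrow>
        (linearly_recurrent (ct_seq p P Q) \<longleftrightarrow> linearly_recurrent (ct_seq p P Q')))"
proof -
  have recurrent: "linearly_recurrent (ct_seq p P Q)"
    if "prime p" "\<forall>n. \<not> int p dvd ct (P ^ n)" for p and P Q :: "'r laurent"
    using that by (intro ct_seq_linearly_recurrent) auto
  have recurrent_iff: "linearly_recurrent (ct_seq p P Q) \<longleftrightarrow> (\<forall>n. \<not> int p dvd ct (P ^ n))"
    if p: "prime p" and nz: "\<exists>n. ct_seq p P Q n \<noteq> 0" for p and P Q :: "'r laurent"
  proof
    assume rec: "linearly_recurrent (ct_seq p P Q)"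
    show "\<forall>n. \<not> int p dvd ct (P ^ n)"
    proof (rule allI notI)+
      fix n assume n: "int p dvd ct (P ^ n)"
      obtain N w where Nw: "N \<ge> 2" "digit_forces (ct_seq p P Q) 0 N w"
        by (rule ct_seq_digit_forces[OF p n])
      obtain n0 where "ct_seq p P Q n0 \<noteq> 0" using nz by blast
      then have "\<not> uniformly_recurrent (ct_seq p P Q)"
        by (rule digit_forces_not_uniformly_recurrent[OF Nw])
      then show False using rec by (simp add: linearly_recurrent_def)
    qed
  qed (rule recurrent[OF p])
  have frequency: "has_frequency (ct_seq p P Q) 0 1"
    if p: "prime p" and nr: "\<not> linearly_recurrent (ct_seq p P Q)" for p and P Q :: "'r laurent"
  proof -
    obtain n where n: "int p dvd ct (P ^ n)" using p nr recurrent by blast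
    obtain N w where "w < N" "digit_forces (ct_seq p P Q) 0 N w"
      by (rule ct_seq_digit_forces[OF p n]) blast
    then show ?thesis by (rule digit_forces_has_frequency)
  qed
  \<comment> \<open>Primality stands inside the existential, so that \<open>B\<close> can be chosen
    as a total function of \<open>p\<close> and \<open>d\<close> before \<open>P\<close> is
    given.\<close>
  have "\<exists>b. prime p \<longrightarrow> (\<forall>(P :: 'r laurent) n. laurent_deg P \<le> d \<and> int p dvd ct (P ^ n)
    \<longrightarrow> (\<exists>m<b. int p dvd ct (P ^ m)))" for p d
  proof (cases "prime p")
    case True
    show ?thesis by (rule ct_power_divisible_bound[OF prime_gt_0_nat[OF True], of d]) blast
  qed simp
  then obtain B where B: "\<And>p d n (P :: 'r laurent).
      \<lbrakk>prime p; laurent_deg P \<le> d; int p dvd ct (P ^ n)\<rbrakk> \<Longrightarrow> \<exists>m<B p d. int p dvd ct (P ^ m)"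
    by metis
  have bound: "(\<forall>n. \<not> int p dvd ct (P ^ n)) \<longleftrightarrow> (\<forall>n < B p (laurent_deg P). \<not> int p dvd ct (P ^ n))"
    if "prime p" for p and P :: "'r laurent"
    using B[OF that order_refl] by blast
  show ?thesis
    by (rule exI[of _ B]) (simp add: recurrent recurrent_iff frequency flip: bound)
qed

end
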